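(* Let $M$ be a transversal matroid of rank $r$ on a finite set $E$, and let $\mathcal{A}=(A_i : i\in[r])$ be a presentation of $M$. Then the map $\sigma_\mathcal{A}:2^{[r]}\to 2^{[r]}$ is a closure operator on $[r]$ (i.e. $I\subseteq\sigma_\mathcal{A}(I)$; $I\subseteq J$ implies $\sigma_\mathcal{A}(I)\subseteq\sigma_\mathcal{A}(J)$; $\sigma_\mathcal{A}(\sigma_\mathcal{A}(I))=\sigma_\mathcal{A}(I)$). In the lattice $L_\mathcal{A}$ of $\sigma_\mathcal{A}$-closed sets (ordered by inclusion), the join is given by $I\lor J=I\cup J$ (and the meet by $I\land J=I\cap J$), so $L_\mathcal{A}$ is a distributive lattice. Moreover, both $\emptyset$ and $[r]$ belong to $L_\mathcal{A}$.
   Context: $[r]=\{1,\dots,r\}$. A set system $\mathcal{A}=(A_i:i\in[r])$ on a finite set $E$ is a sequence of subsets of $E$; a partial transversal of $\mathcal{A}$ is a set $X\subseteq E$ for which there is an injection $\phi:X\to[r]$ with $e\in A_{\phi(e)}$ for all $e\in X$. The partial transversals are the independent sets of a matroid $M[\mathcal{A}]$ on $E$; $\mathcal{A}$ is then called a presentation of $M[\mathcal{A}]$, and such matroids are transversal. Throughout, presentations of a rank-$r$ transversal matroid are taken to consist of exactly $r$ sets. Fix an element $x\notin E$. For $I\subseteq[r]$, let $\mathcal{A}^I=(A^I_i:i\in[r])$ where $A^I_i=A_i\cup\{x\}$ if $i\in I$ and $A^I_i=A_i$ otherwise; $M[\mathcal{A}^I]$ is a matroid on $E\cup\{x\}$.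 Define $\sigma_\mathcal{A}(I)=I\cup\{k\in[r]-I : x \text{ is a coloop of } M[\mathcal{A}^I]\backslash A_k\}$, where $\backslash A_k$ denotes deletion of the elements of $A_k$. (Equivalently, $\sigma_\mathcal{A}(I)$ is the largest $K\subseteq[r]$ with $M[\mathcal{A}^K]=M[\mathcal{A}^I]$.) A set $I$ is $\sigma_\mathcal{A}$-closed if $\sigma_\mathcal{A}(I)=I$, and $L_\mathcal{A}$ denotes the set of $\sigma_\mathcal{A}$-closed sets ordered by inclusion. *)

theory Defs
  imports "HOL-Algebra.Lattice"
begin

section \<open>Matroids given by independent sets\<close>

record 'a indep_system =
  ground :: "'a set"
  indep :: "'a set set"

definition matroid :: "'a indep_system \<Rightarrow> bool" where
  "matroid M \<longleftrightarrow>
     finite (ground M) \<and>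
     (\<forall>X \<in> indep M. X \<subseteq> ground M) \<and>
     {} \<in> indep M \<and>
     (\<forall>X \<in> indep M. \<forall>Y. Y \<subseteq> X \<longrightarrow> Y \<in> indep M) \<and>
     (\<forall>X \<in> indep M. \<forall>Y \<in> indep M. card X < card Y \<longrightarrow>
        (\<exists>y \<in> Y - X. insert y X \<in> indep M))"

definition is_basis :: "'a indep_system \<Rightarrow> 'a set \<Rightarrow> bool" where
  "is_basis M B \<longleftrightarrow> B \<in> indep M \<and> (\<forall>X \<in> indep M. B \<subseteq> X \<longrightarrow> X = B)"

definition rank :: "'a indep_system \<Rightarrow> nat" where
  "rank M = Max (card ` indep M)"

definition is_coloop :: "'a indep_system \<Rightarrow> 'a \<Rightarrow> bool" where
  "is_coloop M e \<longleftrightarrow> e \<in> ground M \<and> (\<forall>B. is_basis M B \<longrightarrow> e \<in> B)"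

definition deletion :: "'a indep_system \<Rightarrow> 'a set \<Rightarrow> 'a indep_system" where
  "deletion M D = \<lparr> ground = ground M - D, indep = {X \<in> indep M. X \<subseteq> ground M - D} \<rparr>"


section \<open>Transversal matroids\<close>

text \<open>A set system \<open>(A i : i \<in> {1..r})\<close> is a function \<open>A\<close> together with the number \<open>r\<close>
  of its members; the values of \<open>A\<close> outside \<open>{1..r}\<close> play no role.\<close>

definition set_system :: "'a set \<Rightarrow> nat \<Rightarrow> (nat \<Rightarrow> 'a set) \<Rightarrow> bool" where
  "set_system E r A \<longleftrightarrow> finite E \<and> (\<forall>i \<in> {1..r}. A i \<subseteq> E)"

definition partial_transversal :: "'a set \<Rightarrow> nat \<Rightarrow> (nat \<Rightarrow> 'a set) \<Rightarrow> 'a set \<Rightarrow> bool" where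
  "partial_transversal E r A X \<longleftrightarrow>
     X \<subseteq> E \<and> (\<exists>\<phi>. inj_on \<phi> X \<and> \<phi> ` X \<subseteq> {1..r} \<and> (\<forall>e \<in> X. e \<in> A (\<phi> e)))"

definition matroid_of :: "'a set \<Rightarrow> nat \<Rightarrow> (nat \<Rightarrow> 'a set) \<Rightarrow> 'a indep_system" where
  "matroid_of E r A = \<lparr> ground = E, indep = {X. partial_transversal E r A X} \<rparr>"

definition presentation :: "nat \<Rightarrow> (nat \<Rightarrow> 'a set) \<Rightarrow> 'a indep_system \<Rightarrow> bool" where
  "presentation r A M \<longleftrightarrow> set_system (ground M) r A \<and> M = matroid_of (ground M) r A"

definition transversal_matroid :: "'a indep_system \<Rightarrow> bool" where
  "transversal_matroid M \<longleftrightarrow> (\<exists>s A. presentation s A M)"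

lemma partial_transversal_augment:
  assumes E: "finite E"
    and X: "partial_transversal E r A X" and Y: "partial_transversal E r A Y"
    and less: "card X < card Y"
  shows "\<exists>y \<in> Y - X. partial_transversal E r A (insert y X)"
proof -
  from Y obtain \<psi> where \<psi>: "inj_on \<psi> Y" "\<psi> ` Y \<subseteq> {1..r}" "\<forall>e \<in> Y. e \<in> A (\<psi> e)"
    and YE: "Y \<subseteq> E" unfolding partial_transversal_def by blast
  from X have XE: "X \<subseteq> E" unfolding partial_transversal_def by blast
  have fin: "finite X" "finite Y" using XE YE E finite_subset by auto
  have main: ?thesis
    if "inj_on \<phi> X" "\<phi> ` X \<subseteq> {1..r}" "\<forall>e \<in> X. e \<in> A (\<phi> e)" for \<phi>
    using that
  proof (induction "card {e \<in> X \<inter> Y. \<phi> e \<noteq> \<psi> e}" arbitrary: \<phi> rule: less_induct)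
    case less': less
    have "card (\<phi> ` X) < card (\<psi> ` Y)"
      using less less'.prems \<psi> by (simp add: card_image)
    moreover have "finite (\<phi> ` X)" using fin(1) by simp
    ultimately have "\<not> \<psi> ` Y \<subseteq> \<phi> ` X" using card_mono not_less by blast
    then obtain y where y: "y \<in> Y" "\<psi> y \<notin> \<phi> ` X" by blast
    let ?\<phi> = "\<phi>(y := \<psi> y)"
    have inj: "inj_on ?\<phi> (insert y X)"
    proof -
      have "inj_on ?\<phi> (X - {y})"
        using inj_on_subset[OF less'.prems(1), of "X - {y}"] by (simp add: inj_on_def)
      moreover have "?\<phi> y \<notin> ?\<phi> ` (X - {y} - {y})"
        using y(2) by (auto split: if_splits)
      ultimately have "inj_on ?\<phi> (insert y (X - {y}))" unfolding inj_on_insert by blast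
      then show ?thesis by simp
    qed
    have rng: "?\<phi> ` insert y X \<subseteq> {1..r}"
    proof (rule image_subsetI)
      fix e assume "e \<in> insert y X"
      moreover have "\<psi> y \<in> {1..r}" by (rule subsetD[OF \<psi>(2) imageI[OF y(1)]])
      moreover have "\<phi> e \<in> {1..r}" if "e \<in> X"
        by (rule subsetD[OF less'.prems(2) imageI[OF that]])
      ultimately show "?\<phi> e \<in> {1..r}"
        unfolding fun_upd_apply by (simp only: insert_iff split: if_split) blast
    qed
    have mem: "\<forall>e \<in> insert y X. e \<in> A (?\<phi> e)"
      using less'.prems(3) bspec[OF \<psi>(3) y(1)] by simp
    show ?case
    proof (cases "y \<in> X")
      case False
      have "partial_transversal E r A (insert y X)"
        unfolding partial_transversal_def using inj rng mem XE YE y(1) by blast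
      then show ?thesis using False y(1) by blast
    next
      case True
      then have ins: "insert y X = X" by blast
      have "{e \<in> X \<inter> Y. ?\<phi> e \<noteq> \<psi> e} \<subset> {e \<in> X \<inter> Y. \<phi> e \<noteq> \<psi> e}"
      proof (rule psubsetI)
        show "{e \<in> X \<inter> Y. ?\<phi> e \<noteq> \<psi> e} \<subseteq> {e \<in> X \<inter> Y. \<phi> e \<noteq> \<psi> e}"
          by auto
        have "\<phi> y \<noteq> \<psi> y" using y(2) True by (metis imageI)
        then have "y \<in> {e \<in> X \<inter> Y. \<phi> e \<noteq> \<psi> e}" using True y(1) by simp
        moreover have "y \<notin> {e \<in> X \<inter> Y. ?\<phi> e \<noteq> \<psi> e}" by simp
        ultimately show "{e \<in> X \<inter> Y. ?\<phi> e \<noteq> \<psi> e} \<noteq> {e \<in> X \<inter> Y. \<phi> e \<noteq> \<psi> e}"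
          by blast
      qed
      then have "card {e \<in> X \<inter> Y. ?\<phi> e \<noteq> \<psi> e} < card {e \<in> X \<inter> Y. \<phi> e \<noteq> \<psi> e}"
        using fin by (intro psubset_card_mono) auto
      then show ?thesis
        using less'.hyps inj rng mem unfolding ins by blast
    qed
  qed
  from X obtain \<phi> where "inj_on \<phi> X" "\<phi> ` X \<subseteq> {1..r}" "\<forall>e \<in> X. e \<in> A (\<phi> e)"
    unfolding partial_transversal_def by blast
  then show ?thesis by (rule main)
qed

lemma matroid_matroid_of:
  assumes "finite E"
  shows "matroid (matroid_of E r A)"
proof -
  have sub: "partial_transversal E r A Y"
    if "partial_transversal E r A X" "Y \<subseteq> X" for X Y
  proof -
    from that(1) obtain \<phi> where "inj_on \<phi> X" "\<phi> ` X \<subseteq> {1..r}" "\<forall>e \<in> X. e \<in> A (\<phi> e)" "X \<subseteq> E"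
      unfolding partial_transversal_def by blast
    then have "inj_on \<phi> Y" "\<phi> ` Y \<subseteq> {1..r}" "\<forall>e \<in> Y. e \<in> A (\<phi> e)" "Y \<subseteq> E"
      using that(2) image_mono[OF that(2), of \<phi>] inj_on_subset[of \<phi> X Y]
      by (simp_all only: subset_eq) simp_all
    then show ?thesis unfolding partial_transversal_def by blast
  qed
  have ground: "ground (matroid_of E r A) = E"
    and indep: "\<And>X. X \<in> indep (matroid_of E r A) \<longleftrightarrow> partial_transversal E r A X"
    by (simp_all add: matroid_of_def)
  show ?thesis
    unfolding matroid_def ground indep Ball_def
  proof (intro conjI allI impI)
    show "partial_transversal E r A {}" by (simp add: partial_transversal_def)
    show "X \<subseteq> E" if "partial_transversal E r A X" for X
      using that by (simp add: partial_transversal_def)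
    show "partial_transversal E r A Y" if "partial_transversal E r A X" "Y \<subseteq> X" for X Y
      using that by (rule sub)
    show "\<exists>y \<in> Y - X. partial_transversal E r A (insert y X)"
      if "partial_transversal E r A X" "partial_transversal E r A Y" "card X < card Y" for X Y
      using assms that by (rule partial_transversal_augment)
  qed (rule assms)
qed

lemma matroid_transversal_matroid:
  assumes "transversal_matroid M"
  shows "matroid M"
proof -
  obtain s A where *: "finite (ground M)" "M = matroid_of (ground M) s A"
    using assms unfolding transversal_matroid_def presentation_def set_system_def by blast
  show ?thesis by (subst *(2)) (rule matroid_matroid_of[OF *(1)])
qed


section \<open>Single-element extensions of a presentation\<close>

definition extend_sets :: "(nat \<Rightarrow> 'a set) \<Rightarrow> 'a \<Rightarrow> nat set \<Rightarrow> nat \<Rightarrow> 'a set" where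
  "extend_sets A x I = (\<lambda>i. if i \<in> I then A i \<union> {x} else A i)"

definition extension :: "'a set \<Rightarrow> nat \<Rightarrow> (nat \<Rightarrow> 'a set) \<Rightarrow> 'a \<Rightarrow> nat set \<Rightarrow> 'a indep_system" where
  "extension E r A x I = matroid_of (E \<union> {x}) r (extend_sets A x I)"

definition \<sigma> :: "'a set \<Rightarrow> nat \<Rightarrow> (nat \<Rightarrow> 'a set) \<Rightarrow> 'a \<Rightarrow> nat set \<Rightarrow> nat set" where
  "\<sigma> E r A x I = I \<union> {k \<in> {1..r} - I. is_coloop (deletion (extension E r A x I) (A k)) x}"

definition closed_sets_lattice ::
    "'a set \<Rightarrow> nat \<Rightarrow> (nat \<Rightarrow> 'a set) \<Rightarrow> 'a \<Rightarrow> nat set gorder" where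
  "closed_sets_lattice E r A x =
     \<lparr> carrier = {I. I \<subseteq> {1..r} \<and> \<sigma> E r A x I = I}, eq = (=), le = (\<subseteq>) \<rparr>"


section \<open>Closure operators and distributive lattices\<close>

definition closure_operator :: "'b set \<Rightarrow> ('b set \<Rightarrow> 'b set) \<Rightarrow> bool" where
  "closure_operator S c \<longleftrightarrow>
     (\<forall>I. I \<subseteq> S \<longrightarrow> c I \<subseteq> S) \<and>
     (\<forall>I. I \<subseteq> S \<longrightarrow> I \<subseteq> c I) \<and>
     (\<forall>I J. I \<subseteq> J \<and> J \<subseteq> S \<longrightarrow> c I \<subseteq> c J) \<and>
     (\<forall>I. I \<subseteq> S \<longrightarrow> c (c I) = c I)"

definition distributive_lattice :: "('b, 'c) gorder_scheme \<Rightarrow> bool" where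
  "distributive_lattice L \<longleftrightarrow>
     lattice L \<and>
     (\<forall>a \<in> carrier L. \<forall>b \<in> carrier L. \<forall>c \<in> carrier L.
        a \<sqinter>\<^bsub>L\<^esub> (b \<squnion>\<^bsub>L\<^esub> c) = (a \<sqinter>\<^bsub>L\<^esub> b) \<squnion>\<^bsub>L\<^esub> (a \<sqinter>\<^bsub>L\<^esub> c))"

end

theory Submission
  imports Defs
begin

text \<open>
  A matching that leaves the index \<open>i\<close> unused is a matching of the system \<open>A(i := {})\<close>.  The element
  \<open>x\<close> is a coloop of the extension by \<open>I\<close> with \<open>A k\<close> deleted iff every partial transversal disjoint
  from \<open>A k\<close> has a matching leaving some \<open>i \<in> I\<close> unused.  By an exchange argument
  (\<open>max_partial_transversal_drop\<close>), whether a maximum partial transversal can leave \<open>i\<close> unused does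
  not depend on which one is taken.  Hence \<open>k \<in> \<sigma> I\<close> iff \<open>i\<close> is related to \<open>k\<close> for some \<open>i \<in> I\<close>,
  where the relation does not depend on \<open>I\<close>; so \<open>\<sigma>\<close> commutes with unions.  Idempotence is
  transitivity of this relation: if \<open>Y\<close> is a minimal set with a matching that leaves \<open>i\<close> unused but
  none that leaves \<open>j\<close> unused, the same exchange argument shows that \<open>Y\<close> is disjoint from \<open>A i\<close>.
\<close>

section \<open>Partial transversals\<close>

lemma partial_transversalI:
  "X \<subseteq> E \<Longrightarrow> inj_on f X \<Longrightarrow> f ` X \<subseteq> {1..r} \<Longrightarrow> (\<And>e. e \<in> X \<Longrightarrow> e \<in> A (f e))
    \<Longrightarrow> partial_transversal E r A X"
  unfolding partial_transversal_def by blast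

lemma partial_transversalE:
  assumes "partial_transversal E r A X"
  obtains f where "X \<subseteq> E" "inj_on f X" "f ` X \<subseteq> {1..r}" "\<And>e. e \<in> X \<Longrightarrow> e \<in> A (f e)"
  using assms unfolding partial_transversal_def by blast

text \<open>The old matching is restricted to \<open>Y\<close>. Since \<open>A\<close> and
  \<open>B\<close> are compared only on elements of \<open>Y\<close>, one rule serves for passing to
  subsets, changing the ground set, and emptying a set that \<open>Y\<close> does not meet.\<close>

lemma partial_transversal_mono:
  assumes "partial_transversal E r A X" "Y \<subseteq> X" "Y \<subseteq> F"
    and "\<And>e i. e \<in> Y \<Longrightarrow> e \<in> A i \<Longrightarrow> e \<in> B i"
  shows "partial_transversal F r B Y"
proof -
  from assms(1) obtain f where f: "inj_on f X" "f ` X \<subseteq> {1..r}" "\<And>e. e \<in> X \<Longrightarrow> e \<in> A (f e)"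
    by (rule partial_transversalE) blast
  show ?thesis
  proof (rule partial_transversalI)
    show "inj_on f Y" using f(1) assms(2) by (rule inj_on_subset)
    show "f ` Y \<subseteq> {1..r}" using f(2) assms(2) by blast
    show "e \<in> B (f e)" if "e \<in> Y" for e using f(3) assms(2,4) that by blast
  qed (rule assms(3))
qed

lemma partial_transversal_drop_set:
  "partial_transversal E r (A(i := {})) X \<Longrightarrow> partial_transversal E r A X"
  by (frule partial_transversal_mono[of _ _ "A(i := {})" _ X E A])
    (auto simp: partial_transversal_def split: if_splits)

text \<open>The index \<open>i\<close> is free in a matching of \<open>A(i := {})\<close>, so a new
  \<open>y\<close> can be matched to it.\<close>

lemma partial_transversal_insert:
  assumes "partial_transversal E r (A(i := {})) X" "i \<in> {1..r}" "y \<in> A i" "y \<in> E"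
  shows "partial_transversal E r A (insert y X)"
proof (cases "y \<in> X")
  case True
  then show ?thesis using partial_transversal_drop_set[OF assms(1)] by (simp add: insert_absorb)
next
  case False
  from assms(1) obtain f where f: "X \<subseteq> E" "inj_on f X" "f ` X \<subseteq> {1..r}"
    "\<And>e. e \<in> X \<Longrightarrow> e \<in> (A(i := {})) (f e)"
    by (rule partial_transversalE) blast
  have ni: "f e \<noteq> i \<and> e \<in> A (f e)" if "e \<in> X" for e
    using f(4)[OF that] by (auto split: if_splits)
  show ?thesis
  proof (rule partial_transversalI)
    show "inj_on (f(y := i)) (insert y X)"
      using f(2) ni False by (auto simp: inj_on_def)
    show "(f(y := i)) ` insert y X \<subseteq> {1..r}"
      using f(3) assms(2) False by auto
    show "e \<in> A ((f(y := i)) e)" if "e \<in> insert y X" for e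
      using that ni assms(3) by auto
  qed (use f(1) assms(4) in auto)
qed

text \<open>By injectivity at most one element is matched to \<open>i\<close>; this element is
  \<open>y\<close>, and removing it frees \<open>i\<close>.\<close>

lemma partial_transversal_remove:
  assumes "partial_transversal E r A X" "i \<in> {1..r}"
  obtains "partial_transversal E r (A(i := {})) X"
  | y where "y \<in> X" "y \<in> A i" "partial_transversal E r (A(i := {})) (X - {y})"
proof -
  from assms(1) obtain f where f: "X \<subseteq> E" "inj_on f X" "f ` X \<subseteq> {1..r}"
    "\<And>e. e \<in> X \<Longrightarrow> e \<in> A (f e)"
    by (rule partial_transversalE) blast
  have sub: "partial_transversal E r (A(i := {})) Z" if Z: "Z \<subseteq> X" "i \<notin> f ` Z" for Z
  proof (rule partial_transversalI)
    show "inj_on f Z" using f(2) Z(1) by (rule inj_on_subset)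
    show "f ` Z \<subseteq> {1..r}" "Z \<subseteq> E" using f(1,3) Z(1) by auto
    show "e \<in> (A(i := {})) (f e)" if "e \<in> Z" for e
      using f(4)[of e] Z that by auto
  qed
  show thesis
  proof (cases "i \<in> f ` X")
    case False
    then show ?thesis using sub[of X] that(1) by blast
  next
    case True
    then obtain y where y: "y \<in> X" "f y = i" by blast
    have "i \<notin> f ` (X - {y})" using f(2) y by (auto simp: inj_on_def)
    then show ?thesis using sub[of "X - {y}"] that(2)[of y] y f(4) by blast
  qed
qed

text \<open>If a matching of \<open>Y\<close> uses \<open>i\<close> on \<open>y\<close>, then
  \<open>Y - {y}\<close> can be augmented from \<open>X\<close> without using \<open>i\<close>. A
  new element other than \<open>y\<close> would let \<open>y\<close> take \<open>i\<close> again and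
  make \<open>Y\<close> larger, against maximality; so the new element is \<open>y\<close>
  itself.\<close>

lemma max_partial_transversal_drop:
  assumes E: "finite E" and i: "i \<in> {1..r}"
    and Y: "partial_transversal E r A Y"
    and max: "\<And>Z. partial_transversal E r A Z \<Longrightarrow> card Z \<le> card Y"
    and X: "partial_transversal E r (A(i := {})) X" and card: "card X = card Y"
  shows "partial_transversal E r (A(i := {})) Y"
  using Y i
proof (cases rule: partial_transversal_remove)
  case (2 y)
  have YE: "Y \<subseteq> E" using Y by (simp add: partial_transversal_def)
  then have fin: "finite Y" using E finite_subset by blast
  have cY: "Suc (card (Y - {y})) = card Y" using fin 2(1) by (rule card_Suc_Diff1)
  then have "card (Y - {y}) < card X" using card by simp
  from partial_transversal_augment[OF E 2(3) X this]
  obtain z where z: "z \<notin> Y - {y}" "partial_transversal E r (A(i := {})) (insert z (Y - {y}))"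
    by blast
  show ?thesis
  proof (cases "z = y")
    case True
    then show ?thesis using z(2) 2(1) by (simp add: insert_absorb)
  next
    case False
    have "partial_transversal E r A (insert y (insert z (Y - {y})))"
      using i 2(1,2) YE by (intro partial_transversal_insert[OF z(2)]) auto
    moreover have "insert y (insert z (Y - {y})) = insert z Y" using 2(1) by blast
    ultimately have "card (insert z Y) \<le> card Y" using max by simp
    moreover have "z \<notin> Y" using z(1) False by blast
    ultimately show ?thesis using fin by simp
  qed
qed

text \<open>An extension of \<open>Y\<close> that is largest among extensions is largest among all
  partial transversals, because augmentation adds elements without giving any up.\<close>

lemma finite_max_card_partial_transversal:
  assumes "finite E" "partial_transversal E r A Y"
  obtains Z where "Y \<subseteq> Z" "partial_transversal E r A Z"
    "\<And>W. partial_transversal E r A W \<Longrightarrow> card W \<le> card Z"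
proof -
  have fin: "finite W" if "partial_transversal E r A W" for W
    using that assms(1) finite_subset unfolding partial_transversal_def by blast
  have bound: "card W < Suc (card E)" if "partial_transversal E r A W" for W
    using that assms(1) card_mono[of E W] unfolding partial_transversal_def by auto
  obtain Z where Z: "Y \<subseteq> Z" "partial_transversal E r A Z"
    and le: "\<And>W. Y \<subseteq> W \<and> partial_transversal E r A W \<Longrightarrow> card W \<le> card Z"
    using ex_has_greatest_nat[of "\<lambda>W. Y \<subseteq> W \<and> partial_transversal E r A W" Y card "Suc (card E)"]
      assms(2) bound by (metis less_imp_le order_refl)
  have "card W \<le> card Z" if W: "partial_transversal E r A W" for W
  proof (rule ccontr)
    assume "\<not> card W \<le> card Z"
    then have "card Z < card W" by simp
    from partial_transversal_augment[OF assms(1) Z(2) W this]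
    obtain w where w: "w \<notin> Z" "partial_transversal E r A (insert w Z)" by blast
    then have "card (insert w Z) \<le> card Z" using le[of "insert w Z"] Z(1) by blast
    then show False using w(1) fin[OF Z(2)] by simp
  qed
  then show thesis using that Z by blast
qed

section \<open>The relation generating the closure\<close>

text \<open>For a presentation on \<open>E\<close>, indices in range and \<open>x\<close> outside
  \<open>E\<close>, this says \<open>k \<in> \<sigma> E r A x {i}\<close>, stated without
  \<open>x\<close>. Deleting \<open>A k\<close> becomes the ground set \<open>E - A k\<close>, and
  reserving \<open>i\<close> for \<open>x\<close> becomes emptying \<open>A i\<close>.\<close>

definition avoidable :: "'a set \<Rightarrow> nat \<Rightarrow> (nat \<Rightarrow> 'a set) \<Rightarrow> nat \<Rightarrow> nat \<Rightarrow> bool" where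
  "avoidable E r A k i \<longleftrightarrow>
     (\<forall>Y. partial_transversal (E - A k) r A Y \<longrightarrow>
          partial_transversal (E - A k) r (A(i := {})) Y)"

lemma avoidable_refl: "avoidable E r A k k"
  unfolding avoidable_def
proof (intro allI impI)
  fix Y assume Y: "partial_transversal (E - A k) r A Y"
  then have "Y \<subseteq> E - A k" by (simp add: partial_transversal_def)
  then show "partial_transversal (E - A k) r (A(k := {})) Y"
    by (intro partial_transversal_mono[OF Y]) auto
qed

text \<open>The point is the exchange of quantifiers: one \<open>i\<close> serves every
  \<open>Y\<close>. An index left free by one maximum partial transversal can be left free by all of
  them, hence by their subsets.\<close>

lemma bex_avoidable_iff:
  assumes E: "finite E" and I: "I \<subseteq> {1..r}"
  shows "(\<exists>i \<in> I. avoidable E r A k i) \<longleftrightarrow>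
    (\<forall>Y. partial_transversal (E - A k) r A Y \<longrightarrow>
      (\<exists>i \<in> I. partial_transversal (E - A k) r (A(i := {})) Y))" (is "?L \<longleftrightarrow> ?R")
proof
  assume ?L
  then show ?R unfolding avoidable_def by blast
next
  assume R: ?R
  let ?F = "E - A k"
  have F: "finite ?F" using E by simp
  have "partial_transversal ?F r A {}" by (simp add: partial_transversal_def)
  then obtain B where B: "partial_transversal ?F r A B"
    and Bmax: "\<And>W. partial_transversal ?F r A W \<Longrightarrow> card W \<le> card B"
    using finite_max_card_partial_transversal[OF F] by metis
  \<comment> \<open>The uniform index is the one that the right-hand side provides for the maximum
    \<open>B\<close>.\<close>
  obtain i where i: "i \<in> I" and Bi: "partial_transversal ?F r (A(i := {})) B"
    using R B by blast
  have "avoidable E r A k i"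
    unfolding avoidable_def
  proof (intro allI impI)
    fix Y assume Y: "partial_transversal ?F r A Y"
    obtain Z where Z: "Y \<subseteq> Z" "partial_transversal ?F r A Z"
      and Zmax: "\<And>W. partial_transversal ?F r A W \<Longrightarrow> card W \<le> card Z"
      using finite_max_card_partial_transversal[OF F Y] by metis
    have "card B = card Z" using Bmax[OF Z(2)] Zmax[OF B] by simp
    then have "partial_transversal ?F r (A(i := {})) Z"
      using max_partial_transversal_drop[OF F _ Z(2) Zmax Bi] i I by blast
    then show "partial_transversal ?F r (A(i := {})) Y"
      using Z(1) Y by (elim partial_transversal_mono) (auto simp: partial_transversal_def)
  qed
  then show ?L using i by blast
qed

text \<open>The hypothesis \<open>av\<close> covers only sets disjoint from \<open>A i\<close>; this
  lifts it to every set that can be matched without \<open>i\<close>. Induction on proper subsets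
  reduces to a minimal counterexample, which turns out to be disjoint from
  \<open>A i\<close>.\<close>

lemma avoidable_imp_drop_set:
  assumes E: "finite E" and ij: "i \<in> {1..r}" "j \<in> {1..r}"
    and av: "avoidable E r A i j"
    and Y: "partial_transversal E r (A(i := {})) Y"
  shows "partial_transversal E r (A(j := {})) Y"
proof (cases "i = j")
  case True
  then show ?thesis using Y by simp
next
  case neq: False
  have "finite Y" using Y E finite_subset unfolding partial_transversal_def by blast
  then show ?thesis using Y
  proof (induction Y rule: finite_psubset_induct)
    case (psubset Z)
    note Zi = psubset.prems
    have ZE: "Z \<subseteq> E" using Zi by (simp add: partial_transversal_def)
    have sub: "partial_transversal E r (A(j := {})) W" if "W \<subset> Z" for W
      using that Zi ZE
      by (intro psubset.IH) (auto intro!: partial_transversal_mono[OF Zi])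
    show ?case
    proof (rule ccontr)
      assume Zj: "\<not> partial_transversal E r (A(j := {})) Z"
      have "Z \<inter> A i = {}"
      proof (rule ccontr)
        assume "Z \<inter> A i \<noteq> {}"
        then obtain z where z: "z \<in> Z" "z \<in> A i" by blast
        let ?B = "A(j := {})"
        have twist: "?B(i := {}) = A(i := {}, j := {})" using neq by (rule fun_upd_twist[symmetric])
        \<comment> \<open>A matching of \<open>Z\<close> without \<open>i\<close> must use
          \<open>j\<close>, since \<open>Zj\<close> forbids leaving \<open>j\<close> free;
          \<open>z'\<close> is the element matched to \<open>j\<close>. The rest of \<open>Z\<close>
          uses neither index.\<close>
        obtain z' where z': "z' \<in> Z" and Zz': "partial_transversal E r (?B(i := {})) (Z - {z'})"
          using Zi ij(2)
        proof (cases rule: partial_transversal_remove)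
          case 1
          then have "partial_transversal E r (?B(i := {})) Z" unfolding twist .
          then show ?thesis using Zj partial_transversal_drop_set by blast
        next
          case (2 y)
          then show ?thesis using that unfolding twist by blast
        qed
        \<comment> \<open>With \<open>Z\<close> as ground set, \<open>Z - {z}\<close> is a maximum
          partial transversal of \<open>?B\<close>: only \<open>Z\<close> itself would be larger,
          and \<open>Zj\<close> excludes it.\<close>
        have small: "card W \<le> card (Z - {z})" if W: "partial_transversal Z r ?B W" for W
        proof -
          have "W \<subseteq> Z" using W by (simp add: partial_transversal_def)
          moreover have "W \<noteq> Z" using W Zj ZE partial_transversal_mono[OF W, of Z E ?B] by auto
          ultimately have "card W < card Z" using psubset.hyps by (simp add: psubset_card_mono)
          then show ?thesis using psubset.hyps z(1) by simp
        qed
        have "partial_transversal Z r (?B(i := {})) (Z - {z})"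
        proof (rule max_partial_transversal_drop[OF psubset.hyps(1) ij(1) _ small])
          show "partial_transversal Z r ?B (Z - {z})"
            using z(1) by (intro partial_transversal_mono[OF sub[of "Z - {z}"]]) auto
          show "partial_transversal Z r (?B(i := {})) (Z - {z'})"
            using Zz' by (elim partial_transversal_mono) auto
          show "card (Z - {z'}) = card (Z - {z})" using z(1) z' by simp
        qed
        \<comment> \<open>Now \<open>Z - {z}\<close> leaves \<open>i\<close> free, and
          \<open>z\<close> lies in \<open>A i\<close>; matching \<open>z\<close> to \<open>i\<close>
          yields a matching of \<open>Z\<close> without \<open>j\<close>, contradicting
          \<open>Zj\<close>.\<close>
        from partial_transversal_insert[OF this ij(1), of z]
        have "partial_transversal Z r ?B (insert z (Z - {z}))"
          using z neq by (simp del: insert_Diff_single)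
        then have "partial_transversal Z r ?B Z" using z(1) by (simp add: insert_absorb)
        then have "partial_transversal E r ?B Z" using ZE by (elim partial_transversal_mono) auto
        then show False using Zj by blast
      qed
      then have "partial_transversal (E - A i) r A Z"
        using ZE by (intro partial_transversal_mono[OF partial_transversal_drop_set[OF Zi]]) auto
      then have "partial_transversal (E - A i) r (A(j := {})) Z"
        using av unfolding avoidable_def by blast
      then have "partial_transversal E r (A(j := {})) Z"
        using ZE by (elim partial_transversal_mono) auto
      then show False using Zj by blast
    qed
  qed
qed

text \<open>A set disjoint from \<open>A k\<close> may meet \<open>A i\<close>, so
  \<open>ij'\<close> does not apply to it directly; its lifted form
  \<open>avoidable_imp_drop_set\<close> does.\<close>

lemma avoidable_trans:
  assumes E: "finite E" and ij: "i \<in> {1..r}" "j \<in> {1..r}"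
    and ki: "avoidable E r A k i" and ij': "avoidable E r A i j"
  shows "avoidable E r A k j"
  unfolding avoidable_def
proof (intro allI impI)
  fix Y assume "partial_transversal (E - A k) r A Y"
  then have Y: "partial_transversal (E - A k) r (A(i := {})) Y"
    using ki unfolding avoidable_def by blast
  then have YE: "Y \<subseteq> E - A k" by (simp add: partial_transversal_def)
  have "partial_transversal E r (A(i := {})) Y"
    using YE by (intro partial_transversal_mono[OF Y]) auto
  then have "partial_transversal E r (A(j := {})) Y"
    by (rule avoidable_imp_drop_set[OF E ij ij'])
  then show "partial_transversal (E - A k) r (A(j := {})) Y"
    using YE by (elim partial_transversal_mono) auto
qed

section \<open>Coloops and the operator \<open>\<sigma>\<close>\<close>

lemma matroid_deletion:
  assumes "matroid M"
  shows "matroid (deletion M D)"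
  unfolding matroid_def
proof (intro conjI ballI allI impI)
  fix X Y assume XY: "X \<in> indep (deletion M D)" "Y \<in> indep (deletion M D)" "card X < card Y"
  then have "X \<in> indep M" "Y \<in> indep M" by (auto simp: deletion_def)
  then obtain y where "y \<in> Y - X" "insert y X \<in> indep M"
    using assms XY(3) unfolding matroid_def by blast
  then show "\<exists>y \<in> Y - X. insert y X \<in> indep (deletion M D)"
    using XY by (auto simp: deletion_def)
qed (use assms in \<open>auto simp: matroid_def deletion_def\<close>)

lemma indep_subset_basis:
  assumes "matroid M" "X \<in> indep M"
  obtains B where "is_basis M B" "X \<subseteq> B"
proof -
  have "indep M \<subseteq> Pow (ground M)" "finite (ground M)" using assms(1) by (auto simp: matroid_def)
  then have "finite (indep M)" using finite_subset by blast
  from finite_has_maximal2[OF this assms(2)]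
  obtain B where B: "B \<in> indep M" "X \<subseteq> B" "\<forall>Y \<in> indep M. B \<subseteq> Y \<longrightarrow> B = Y" by blast
  have "is_basis M B" using B(1,3) by (auto simp: is_basis_def)
  then show thesis using B(2) by (rule that)
qed

text \<open>Every independent set lies in a basis, and a basis is maximal; so the condition on bases
  becomes one on independent sets, which can be tested by matchings.\<close>

lemma is_coloop_iff:
  assumes "matroid M"
  shows "is_coloop M e \<longleftrightarrow> e \<in> ground M \<and> (\<forall>X \<in> indep M. insert e X \<in> indep M)"
proof
  assume e: "is_coloop M e"
  have "insert e X \<in> indep M" if X: "X \<in> indep M" for X
  proof -
    obtain B where B: "is_basis M B" "X \<subseteq> B" using indep_subset_basis[OF assms X] .
    then have "insert e X \<subseteq> B" "B \<in> indep M" using e by (auto simp: is_coloop_def is_basis_def)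
    then show ?thesis using assms unfolding matroid_def by blast
  qed
  then show "e \<in> ground M \<and> (\<forall>X \<in> indep M. insert e X \<in> indep M)"
    using e by (simp add: is_coloop_def)
next
  assume "e \<in> ground M \<and> (\<forall>X \<in> indep M. insert e X \<in> indep M)"
  then show "is_coloop M e" unfolding is_coloop_def is_basis_def by blast
qed

section \<open>Matchings of the sets extended by \<open>x\<close>\<close>

lemma partial_transversal_extend_sets:
  assumes "x \<notin> X" "X \<subseteq> E"
  shows "partial_transversal (E \<union> {x}) r (extend_sets A x I) X \<longleftrightarrow> partial_transversal E r A X"
proof
  show "partial_transversal E r A X" if "partial_transversal (E \<union> {x}) r (extend_sets A x I) X"
    using that assms by (elim partial_transversal_mono) (auto simp: extend_sets_def split: if_splits)
  show "partial_transversal (E \<union> {x}) r (extend_sets A x I) X" if "partial_transversal E r A X"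
    using that assms by (elim partial_transversal_mono) (auto simp: extend_sets_def)
qed

text \<open>As \<open>x\<close> lies outside \<open>E\<close>, only the extended sets with index in
  \<open>I\<close> contain it. Matching \<open>insert x X\<close> thus means picking some
  \<open>i\<close> in \<open>I\<close> for \<open>x\<close> and matching \<open>X\<close> without
  \<open>i\<close>.\<close>

lemma partial_transversal_extend_sets_insert:
  assumes A: "\<And>i. i \<in> {1..r} \<Longrightarrow> A i \<subseteq> E" and x: "x \<notin> E" and X: "X \<subseteq> E" and I: "I \<subseteq> {1..r}"
  shows "partial_transversal (E \<union> {x}) r (extend_sets A x I) (insert x X) \<longleftrightarrow>
    (\<exists>i \<in> I. partial_transversal E r (A(i := {})) X)" (is "?L \<longleftrightarrow> ?R")
proof
  assume ?L
  then obtain f where f: "inj_on f (insert x X)" "f ` insert x X \<subseteq> {1..r}"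
    "\<And>e. e \<in> insert x X \<Longrightarrow> e \<in> extend_sets A x I (f e)"
    by (rule partial_transversalE) blast
  have xX: "x \<notin> X" using x X by blast
  have "x \<notin> A (f x)" using A[of "f x"] f(2) x by blast
  then have "f x \<in> I" using f(3)[of x] by (auto simp: extend_sets_def split: if_splits)
  moreover have "partial_transversal E r (A(f x := {})) X"
  proof (rule partial_transversalI[OF X])
    show "inj_on f X" using f(1) by simp
    show "f ` X \<subseteq> {1..r}" using f(2) by blast
    show "e \<in> (A(f x := {})) (f e)" if e: "e \<in> X" for e
    proof -
      have "e \<noteq> x" using e xX by blast
      moreover from this have "f e \<noteq> f x" using f(1) e by (auto simp: inj_on_def)
      ultimately show ?thesis using f(3)[of e] e by (auto simp: extend_sets_def split: if_splits)
    qed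
  qed
  ultimately show ?R by blast
next
  assume ?R
  then obtain i where i: "i \<in> I" and Xi: "partial_transversal E r (A(i := {})) X" by blast
  have "partial_transversal (E \<union> {x}) r ((extend_sets A x I)(i := {})) X"
    using X by (intro partial_transversal_mono[OF Xi])
      (auto simp: extend_sets_def split: if_splits)
  then show ?L by (rule partial_transversal_insert) (use i I in \<open>auto simp: extend_sets_def\<close>)
qed

lemma is_coloop_extension_iff:
  assumes E: "finite E" and A: "\<And>i. i \<in> {1..r} \<Longrightarrow> A i \<subseteq> E" and x: "x \<notin> E"
    and I: "I \<subseteq> {1..r}" and k: "k \<in> {1..r}"
  shows "is_coloop (deletion (extension E r A x I) (A k)) x \<longleftrightarrow> (\<exists>i \<in> I. avoidable E r A k i)"
proof -
  let ?N = "deletion (extension E r A x I) (A k)"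
  let ?P = "partial_transversal (E \<union> {x}) r (extend_sets A x I)"
  have mat: "matroid ?N"
    unfolding extension_def using E by (intro matroid_deletion matroid_matroid_of) simp
  have xA: "x \<notin> A k" using A[OF k] x by blast
  have ground: "x \<in> ground ?N" using xA by (simp add: deletion_def extension_def matroid_of_def)
  have indep: "X \<in> indep ?N \<longleftrightarrow> ?P X \<and> X \<inter> A k = {}" for X
    unfolding deletion_def extension_def matroid_of_def
    by (auto simp: partial_transversal_def)
  \<comment> \<open>The family \<open>B\<close> is left general because both \<open>A\<close> and
    \<open>A(i := {})\<close> are needed.\<close>
  have restrict: "partial_transversal E r B X \<longleftrightarrow> partial_transversal (E - A k) r B X"
    if "X \<inter> A k = {}" for B X
    using that unfolding partial_transversal_def by blast
  have ins: "insert x X \<in> indep ?N \<longleftrightarrow> (\<exists>i \<in> I. partial_transversal (E - A k) r (A(i := {})) X)"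
    if "X \<subseteq> E - A k" for X
  proof -
    have "X \<subseteq> E" "X \<inter> A k = {}" using that by auto
    then show ?thesis
      unfolding indep using partial_transversal_extend_sets_insert[OF A x _ I] xA restrict by simp
  qed
  have pt: "X \<in> indep ?N \<longleftrightarrow> partial_transversal (E - A k) r A X" if "X \<subseteq> E - A k" for X
  proof -
    have "X \<subseteq> E" "X \<inter> A k = {}" "x \<notin> X" using that x by auto
    then show ?thesis
      unfolding indep using partial_transversal_extend_sets restrict by metis
  qed
  \<comment> \<open>It is enough to test independent sets without \<open>x\<close>: otherwise
    \<open>x\<close> is taken out first and then put back.\<close>
  have "(\<forall>X \<in> indep ?N. insert x X \<in> indep ?N) \<longleftrightarrow>
    (\<forall>X. X \<subseteq> E - A k \<and> X \<in> indep ?N \<longrightarrow> insert x X \<in> indep ?N)" (is "?L \<longleftrightarrow> ?R")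
  proof
    assume R: ?R
    show ?L
    proof
      fix X assume X: "X \<in> indep ?N"
      have "X - {x} \<in> indep ?N" using mat X unfolding matroid_def by blast
      moreover have "X - {x} \<subseteq> E - A k"
        using X unfolding indep by (auto simp: partial_transversal_def)
      ultimately have "insert x (X - {x}) \<in> indep ?N" using R by blast
      then show "insert x X \<in> indep ?N" by simp
    qed
  qed blast
  also have "\<dots> \<longleftrightarrow> (\<forall>X. partial_transversal (E - A k) r A X \<longrightarrow>
      (\<exists>i \<in> I. partial_transversal (E - A k) r (A(i := {})) X))"
  proof -
    have sub: "X \<subseteq> E - A k" if "partial_transversal (E - A k) r A X" for X
      using that by (simp add: partial_transversal_def)
    then have "X \<subseteq> E - A k \<and> X \<in> indep ?N \<longleftrightarrow> partial_transversal (E - A k) r A X" for X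
      using pt by blast
    then show ?thesis
      using ins sub by simp
  qed
  also have "\<dots> \<longleftrightarrow> (\<exists>i \<in> I. avoidable E r A k i)"
    by (rule bex_avoidable_iff[OF E I, symmetric])
  finally show ?thesis using is_coloop_iff[OF mat] ground by blast
qed

text \<open>The part \<open>I\<close> in the definition of \<open>\<sigma>\<close> is absorbed by
  reflexivity. What remains depends on the elements of \<open>I\<close> one at a time.\<close>

lemma \<sigma>_eq:
  assumes "finite E" "\<And>i. i \<in> {1..r} \<Longrightarrow> A i \<subseteq> E" "x \<notin> E" "I \<subseteq> {1..r}"
  shows "\<sigma> E r A x I = {k \<in> {1..r}. \<exists>i \<in> I. avoidable E r A k i}"
proof -
  have "is_coloop (deletion (extension E r A x I) (A k)) x \<longleftrightarrow> (\<exists>i \<in> I. avoidable E r A k i)"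
    if "k \<in> {1..r}" for k
    using is_coloop_extension_iff[OF assms that] .
  then show ?thesis
    unfolding \<sigma>_def using assms(4) avoidable_refl[of E r A] by blast
qed

section \<open>Lattices of sets\<close>

lemma lattice_of_sets:
  fixes C :: "'b set set"
  assumes un: "\<And>I J. I \<in> C \<Longrightarrow> J \<in> C \<Longrightarrow> I \<union> J \<in> C"
    and int: "\<And>I J. I \<in> C \<Longrightarrow> J \<in> C \<Longrightarrow> I \<inter> J \<in> C"
  defines "L \<equiv> \<lparr> carrier = C, eq = (=), le = (\<subseteq>) \<rparr>"
  shows "lattice L"
    and "\<And>I J. I \<in> C \<Longrightarrow> J \<in> C \<Longrightarrow> I \<squnion>\<^bsub>L\<^esub> J = I \<union> J"
    and "\<And>I J. I \<in> C \<Longrightarrow> J \<in> C \<Longrightarrow> I \<sqinter>\<^bsub>L\<^esub> J = I \<inter> J"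
    and "distributive_lattice L"
proof -
  have C: "carrier L = C" by (simp add: L_def)
  interpret partial_order L
    by unfold_locales (auto simp: L_def)
  have least: "least L (I \<union> J) (Upper L {I, J})" if "I \<in> C" "J \<in> C" for I J
    using that un by (auto simp: least_def Upper_def L_def)
  have greatest: "greatest L (I \<inter> J) (Lower L {I, J})" if "I \<in> C" "J \<in> C" for I J
    using that int by (auto simp: greatest_def Lower_def L_def)
  show lat: "lattice L"
    by unfold_locales (use least greatest C in blast)+
  \<comment> \<open>Joins and meets are chosen with \<open>SOME\<close>, so uniqueness of least and
    greatest elements identifies them.\<close>
  show join: "I \<squnion>\<^bsub>L\<^esub> J = I \<union> J" if "I \<in> C" "J \<in> C" for I J
    unfolding join_def sup_def by (rule some_equality, rule least[OF that], erule least_unique)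
      (rule least[OF that])
  show meet: "I \<sqinter>\<^bsub>L\<^esub> J = I \<inter> J" if "I \<in> C" "J \<in> C" for I J
    unfolding meet_def inf_def by (rule some_equality, rule greatest[OF that], erule greatest_unique)
      (rule greatest[OF that])
  show "distributive_lattice L"
    unfolding distributive_lattice_def C
    using lat by (simp add: join meet un int Int_Un_distrib)
qed

theorem theorem3p1:
  fixes M :: "'a indep_system" and E :: "'a set" and r :: nat
    and A :: "nat \<Rightarrow> 'a set" and x :: 'a
  assumes "finite E" and "ground M = E"
    and "transversal_matroid M" and "rank M = r"
    and "presentation r A M"
    and "x \<notin> E"
  defines "L \<equiv> closed_sets_lattice E r A x"
  shows "closure_operator {1..r} (\<sigma> E r A x)
    \<and> lattice L
    \<and> (\<forall>I \<in> carrier L. \<forall>J \<in> carrier L.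
          I \<squnion>\<^bsub>L\<^esub> J = I \<union> J \<and> I \<sqinter>\<^bsub>L\<^esub> J = I \<inter> J)
    \<and> distributive_lattice L
    \<and> {} \<in> carrier L
    \<and> {1..r} \<in> carrier L"
proof -
  have A: "A i \<subseteq> E" if "i \<in> {1..r}" for i
    using assms(2,5) that unfolding presentation_def set_system_def by blast
  let ?s = "\<sigma> E r A x"
  have s: "?s I = {k \<in> {1..r}. \<exists>i \<in> I. avoidable E r A k i}" if "I \<subseteq> {1..r}" for I
    using \<sigma>_eq[OF assms(1) A assms(6) that] .
  have sub: "?s I \<subseteq> {1..r}" if "I \<subseteq> {1..r}" for I using s[OF that] by blast
  have ext: "I \<subseteq> ?s I" for I by (auto simp: \<sigma>_def)
  have mono: "?s I \<subseteq> ?s J" if "I \<subseteq> J" "J \<subseteq> {1..r}" for I J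
    using s[of I] s[of J] that by blast
  have idem: "?s (?s I) = ?s I" if I: "I \<subseteq> {1..r}" for I
  proof
    show "?s (?s I) \<subseteq> ?s I"
    proof
      fix k assume "k \<in> ?s (?s I)"
      then obtain i j where "k \<in> {1..r}" "i \<in> {1..r}" "j \<in> I"
        "avoidable E r A k i" "avoidable E r A i j"
        using s[OF sub[OF I]] s[OF I] by auto
      then show "k \<in> ?s I" using s[OF I] I avoidable_trans[OF assms(1)] by blast
    qed
  qed (rule ext)
  have clo: "closure_operator {1..r} ?s"
    unfolding closure_operator_def using sub ext mono idem by blast
  define C where "C = {I. I \<subseteq> {1..r} \<and> ?s I = I}"
  have L: "L = \<lparr> carrier = C, eq = (=), le = (\<subseteq>) \<rparr>"
    by (simp add: L_def closed_sets_lattice_def C_def)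
  have un: "I \<union> J \<in> C" if "I \<in> C" "J \<in> C" for I J
  proof -
    have "I \<subseteq> {1..r}" "J \<subseteq> {1..r}" using that by (simp_all add: C_def)
    \<comment> \<open>The existential over single elements of \<open>I\<close> in \<open>s\<close>
      distributes over unions.\<close>
    then have "?s (I \<union> J) = ?s I \<union> ?s J"
      by (subst (1 2 3) s) auto
    then show ?thesis using that by (simp add: C_def)
  qed
  have int: "I \<inter> J \<in> C" if "I \<in> C" "J \<in> C" for I J
  proof -
    have "I \<subseteq> {1..r}" "J \<subseteq> {1..r}" "?s I = I" "?s J = J" using that by (simp_all add: C_def)
    then show ?thesis
      \<comment> \<open>Closed sets of any monotone, extensive operator are stable under
        intersection.\<close>
      using mono[of "I \<inter> J" I] mono[of "I \<inter> J" J] ext[of "I \<inter> J"] by (auto simp: C_def)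
  qed
  have "{} \<in> C" using s[of "{}"] by (simp add: C_def)
  moreover have "{1..r} \<in> C" using sub[of "{1..r}"] ext[of "{1..r}"] by (simp add: C_def)
  ultimately show ?thesis
    using clo lattice_of_sets[OF un int, folded L] by (simp add: L)
qed

end
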